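(* For a permutation $\pi$ of $\{1,\ldots,n\}$, let $t(\pi)$ be the minimum number of stacks in parallel arrangement needed to sort $\pi$. Then for $\pi$ uniformly random, $\mathbb{E}[t(\pi)]=O(\sqrt{n})$.
   Context: Sorting with $T$ parallel stacks: there are $T$ initially empty stacks $S_0,\ldots,S_{T-1}$. The input is a permutation $\pi=(x_1,\ldots,x_n)$ of $\{1,\ldots,n\}$, read from left to right. At each step one may either push the next unread input element onto any one of the stacks, or pop the top element of any one of the stacks and append it to the output. $\pi$ is sorted by $T$ parallel stacks if some sequence of such steps moves all elements to the output and the output is $1,2,\ldots,n$. (For instance, $T=n$ always suffices.) *)

theory Defs
  imports
    "HOL-Probability.Probability"
    "HOL-Combinatorics.Multiset_Permutations"
    "HOL-Library.Landau_Symbols"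
begin

(* A configuration consists of the unread input, the contents of the stacks
   (the head of a list is the top of the stack), and the output produced so far. *)
type_synonym config = "nat list \<times> (nat \<Rightarrow> nat list) \<times> nat list"

inductive stack_step :: "nat \<Rightarrow> config \<Rightarrow> config \<Rightarrow> bool" for T :: nat where
  push: "i < T \<Longrightarrow> stack_step T (x # xs, S, out) (xs, S(i := x # S i), out)"
| pop: "i < T \<Longrightarrow> S i = x # s \<Longrightarrow> stack_step T (xs, S, out) (xs, S(i := s), out @ [x])"

definition sorted_by_stacks :: "nat \<Rightarrow> nat list \<Rightarrow> bool" where
  "sorted_by_stacks T p \<longleftrightarrow>
     (stack_step T)\<^sup>*\<^sup>* (p, \<lambda>_. [], []) ([], \<lambda>_. [], [1..<Suc (length p)])"

definition min_stacks :: "nat list \<Rightarrow> nat" where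
  "min_stacks p = (LEAST T. sorted_by_stacks T p)"

lemma stack_steps_push_all:
  assumes "distinct p" "set p \<subseteq> {1..n}" "\<forall>x\<in>set p. S (x - 1) = []"
  shows "(stack_step n)\<^sup>*\<^sup>* (p, S, out)
           ([], \<lambda>i. if Suc i \<in> set p then [Suc i] else S i, out)"
  using assms
proof (induction p arbitrary: S)
  case Nil
  then show ?case by simp
next
  case (Cons x xs)
  let ?S = "S(x - 1 := x # S (x - 1))"
  have x: "x \<ge> 1" "x \<le> n" using Cons.prems by auto
  then have "x - 1 < n" by simp
  then have 1: "stack_step n (x # xs, S, out) (xs, ?S, out)" by (rule push)
  have "\<forall>y\<in>set xs. ?S (y - 1) = []"
  proof
    fix y assume y: "y \<in> set xs"
    then have "y \<noteq> x" "y \<ge> 1" using Cons.prems by auto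
    then have "y - 1 \<noteq> x - 1" using x by linarith
    then show "?S (y - 1) = []" using y Cons.prems by simp
  qed
  then have 2: "(stack_step n)\<^sup>*\<^sup>* (xs, ?S, out)
      ([], \<lambda>i. if Suc i \<in> set xs then [Suc i] else ?S i, out)"
    using Cons.prems by (intro Cons.IH) auto
  have 3: "(\<lambda>i. if Suc i \<in> set xs then [Suc i] else ?S i) =
      (\<lambda>i. if Suc i \<in> set (x # xs) then [Suc i] else S i)"
    using x Cons.prems by (auto simp: fun_eq_iff)
  show ?case using converse_rtranclp_into_rtranclp[of "stack_step n", OF 1 2] unfolding 3 .
qed

lemma stack_steps_pop_all:
  assumes "k \<le> n"
  shows "(stack_step n)\<^sup>*\<^sup>* ([], \<lambda>i. if i < n then [Suc i] else [], [])
           ([], \<lambda>i. if k \<le> i \<and> i < n then [Suc i] else [], [1..<Suc k])"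
  using assms
proof (induction k)
  case 0
  then show ?case by simp
next
  case (Suc k)
  let ?S = "\<lambda>i. if k \<le> i \<and> i < n then [Suc i] else []"
  have "stack_step n ([], ?S, [1..<Suc k]) ([], ?S(k := []), [1..<Suc k] @ [Suc k])"
    using Suc.prems by (intro pop) auto
  also have "?S(k := []) = (\<lambda>i. if Suc k \<le> i \<and> i < n then [Suc i] else [])"
    by (auto simp: fun_eq_iff)
  finally show ?case using Suc by (simp add: rtranclp.rtrancl_into_rtrancl)
qed

text \<open>The set of admissible numbers of stacks is never empty, so the minimum is attained.\<close>

lemma sorted_by_n_stacks:
  assumes "p \<in> permutations_of_set {1..n}"
  shows "sorted_by_stacks n p"
proof -
  have p: "distinct p" "set p = {1..n}" "length p = n"
    using assms length_finite_permutations_of_set[OF assms] by (auto simp: permutations_of_set_def)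
  have "(stack_step n)\<^sup>*\<^sup>* (p, \<lambda>_. [], [])
      ([], \<lambda>i. if Suc i \<in> set p then [Suc i] else [], [])"
    using p by (intro stack_steps_push_all) auto
  also have "(\<lambda>i. if Suc i \<in> set p then [Suc i] else []) = (\<lambda>i. if i < n then [Suc i] else [])"
    using p by (auto simp: fun_eq_iff)
  also have "(stack_step n)\<^sup>*\<^sup>* ([], \<lambda>i. if i < n then [Suc i] else [], [])
      ([], \<lambda>i. if n \<le> i \<and> i < n then [Suc i] else [], [1..<Suc n])"
    by (rule stack_steps_pop_all) simp
  also have "(\<lambda>i. if n \<le> i \<and> i < n then [Suc i] else []) = (\<lambda>_. [])"
    by (auto simp: fun_eq_iff)
  finally show ?thesis using p by (simp only: sorted_by_stacks_def)
qed

lemma sorted_by_min_stacks: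
  assumes "p \<in> permutations_of_set {1..n}"
  shows "sorted_by_stacks (min_stacks p) p"
  unfolding min_stacks_def by (rule LeastI) (rule sorted_by_n_stacks[OF assms])

end

theory Submission
  imports Defs "HOL-Library.Sublist"
begin

text \<open>
  Read the whole input before popping anything. If the entries of the permutation are coloured so
  that every colour class is a decreasing subsequence, then pushing each colour onto its own stack
  leaves every stack increasing from the top, and the output can be popped in order. Colouring each
  entry by the length of the longest increasing subsequence starting there shows that the number of
  stacks is at most the length of the longest increasing subsequence. A permutation with an increasing
  subsequence of length k is a shuffle of a sorted k-subset with an arrangement of the other
  elements, so a random one has this property with probability at most
  \<open>(n choose k) / k! \<le> (e\<^sup>2 n / k\<^sup>2)^k\<close>. For \<open>k \<ge> 2 e \<surd>n\<close> this is at most \<open>4^-k \<le> 1 / n\<close>, which makes up for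
  the trivial bound n on the number of stacks.
\<close>

subsection \<open>Sorting by a colouring\<close>

text \<open>Pushing reverses reading order, hence \<open>rev\<close>. The initial \<open>S\<close>
  is arbitrary because the induction continues from stacks that are no longer empty.\<close>

lemma stack_steps_push_colours:
  assumes "\<forall>x\<in>set p. c x < T"
  shows "(stack_step T)\<^sup>*\<^sup>* (p, S, out) ([], \<lambda>i. rev (filter (\<lambda>x. c x = i) p) @ S i, out)"
  using assms
proof (induction p arbitrary: S)
  case Nil
  then show ?case by simp
next
  case (Cons x xs)
  let ?S = "S(c x := x # S (c x))"
  have 1: "stack_step T (x # xs, S, out) (xs, ?S, out)"
    using Cons.prems by (intro push) auto
  have 2: "(stack_step T)\<^sup>*\<^sup>* (xs, ?S, out) ([], \<lambda>i. rev (filter (\<lambda>x. c x = i) xs) @ ?S i, out)"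
    using Cons.prems by (intro Cons.IH) auto
  have 3: "(\<lambda>i. rev (filter (\<lambda>x. c x = i) xs) @ ?S i) =
      (\<lambda>i. rev (filter (\<lambda>x. c x = i) (x # xs)) @ S i)"
    by (auto simp: fun_eq_iff)
  show ?case using converse_rtranclp_into_rtranclp[of "stack_step T", OF 1 2] unfolding 3 .
qed

text \<open>After \<open>k\<close> pops the smallest remaining value is \<open>Suc k\<close>, so it
  lies on top of the stack of its colour and can be popped next.\<close>

lemma stack_steps_pop_colours:
  assumes "k \<le> n" "\<forall>x\<in>{1..n}. c x < T"
  shows "(stack_step T)\<^sup>*\<^sup>* ([], \<lambda>i. filter (\<lambda>x. c x = i) [1..<Suc n], [])
           ([], \<lambda>i. filter (\<lambda>x. c x = i) [Suc k..<Suc n], [1..<Suc k])"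
  using assms(1)
proof (induction k)
  case 0
  then show ?case by simp
next
  case (Suc k)
  let ?S = "\<lambda>i. filter (\<lambda>x. c x = i) [Suc k..<Suc n]"
  have upt: "[Suc k..<Suc n] = Suc k # [Suc (Suc k)..<Suc n]"
    using Suc.prems by (simp add: upt_conv_Cons del: upt_Suc)
  have "stack_step T ([], ?S, [1..<Suc k])
      ([], ?S(c (Suc k) := filter (\<lambda>x. c x = c (Suc k)) [Suc (Suc k)..<Suc n]), [1..<Suc k] @ [Suc k])"
    using Suc.prems assms(2) by (intro pop) (auto simp: upt simp del: upt_Suc)
  \<comment> \<open>Stacks of other colours do not contain \<open>Suc k\<close>, so dropping it from
    the range leaves them unchanged.\<close>
  also have "?S(c (Suc k) := filter (\<lambda>x. c x = c (Suc k)) [Suc (Suc k)..<Suc n]) =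
      (\<lambda>i. filter (\<lambda>x. c x = i) [Suc (Suc k)..<Suc n])"
    by (auto simp: fun_eq_iff upt simp del: upt_Suc)
  also have "[1..<Suc k] @ [Suc k] = [1..<Suc (Suc k)]" by simp
  finally show ?case using Suc by (meson Suc_leD rtranclp.rtrancl_into_rtrancl)
qed

lemma sorted_by_stacks_if_coloured:
  assumes p: "p \<in> permutations_of_set {1..n}"
    and T: "\<forall>x\<in>set p. c x < T"
    and c: "sorted_wrt (\<lambda>x y. x < y \<longrightarrow> c x \<noteq> c y) p"
  shows "sorted_by_stacks T p"
proof -
  have p': "distinct p" "set p = {1..n}" "length p = n"
    using p length_finite_permutations_of_set[OF p] by (auto simp: permutations_of_set_def)
  \<comment> \<open>Within one colour class the hypothesis on \<open>c\<close> rules out ascents, so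
    the reversed class is sorted; a sorted distinct list is determined by its set.\<close>
  have "rev (filter (\<lambda>x. c x = i) p) = filter (\<lambda>x. c x = i) [1..<Suc n]" for i
  proof (rule sorted_distinct_set_unique)
    have "sorted_wrt (\<lambda>x y. x < y \<longrightarrow> c x \<noteq> c y) (filter (\<lambda>x. c x = i) p)"
      using c by (rule sorted_wrt_filter)
    then have "sorted_wrt (\<lambda>x y. y \<le> x) (filter (\<lambda>x. c x = i) p)"
      by (rule sorted_wrt_mono_rel[rotated]) force
    then show "sorted (rev (filter (\<lambda>x. c x = i) p))" by (simp add: sorted_wrt_rev)
    show "sorted (filter (\<lambda>x. c x = i) [1..<Suc n])" by (intro sorted_wrt_filter sorted_upt)
  qed (use p' in \<open>auto simp del: upt_Suc\<close>)
  then have "(stack_step T)\<^sup>*\<^sup>* (p, \<lambda>_. [], []) ([], \<lambda>i. filter (\<lambda>x. c x = i) [1..<Suc n], [])"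
    using stack_steps_push_colours[of p c T "\<lambda>_. []" "[]"] T by (simp del: upt_Suc)
  also have "(stack_step T)\<^sup>*\<^sup>* \<dots> ([], \<lambda>i. filter (\<lambda>x. c x = i) [Suc n..<Suc n], [1..<Suc n])"
    using T p' by (intro stack_steps_pop_colours) auto
  finally show ?thesis using p' by (simp add: sorted_by_stacks_def del: upt_Suc)
qed

subsection \<open>Increasing subsequences\<close>

definition has_incr_subseq :: "nat \<Rightarrow> 'a::linorder list \<Rightarrow> bool" where
  "has_incr_subseq k p \<longleftrightarrow> (\<exists>ys. subseq ys p \<and> sorted_wrt (<) ys \<and> length ys = k)"

text \<open>
  For distinct lists, the length, minus one, of the longest increasing subsequence starting at \<open>y\<close>
  (counting from zero makes the values usable as stack indices).
\<close>

fun incr_colour :: "'a::linorder list \<Rightarrow> 'a \<Rightarrow> nat" where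
  "incr_colour [] y = 0"
| "incr_colour (x # xs) y =
     (if y = x then Max (insert 0 (Suc ` incr_colour xs ` {z \<in> set xs. x < z})) else incr_colour xs y)"

text \<open>An increasing subsequence starting at a later, larger entry can be prolonged by
  \<open>x\<close>, so the colour of \<open>x\<close> is strictly bigger.\<close>

lemma sorted_wrt_incr_colour:
  assumes "distinct p"
  shows "sorted_wrt (\<lambda>x y. x < y \<longrightarrow> incr_colour p x \<noteq> incr_colour p y) p"
  using assms
proof (induction p)
  case Nil
  then show ?case by simp
next
  case (Cons x xs)
  have "incr_colour (x # xs) z < incr_colour (x # xs) x" if "z \<in> set xs" "x < z" for z
  proof -
    have "Suc (incr_colour xs z) \<le> Max (insert 0 (Suc ` incr_colour xs ` {z \<in> set xs. x < z}))"
      using that by (intro Max_ge) auto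
    then show ?thesis using that by (metis Suc_le_lessD incr_colour.simps(2) less_irrefl)
  qed
  then have "\<forall>z\<in>set xs. x < z \<longrightarrow> incr_colour (x # xs) x \<noteq> incr_colour (x # xs) z"
    by (metis less_irrefl)
  moreover have "sorted_wrt (\<lambda>y z. y < z \<longrightarrow> incr_colour (x # xs) y \<noteq> incr_colour (x # xs) z) xs"
    using Cons.prems by (intro sorted_wrt_mono_rel[OF _ Cons.IH]) auto
  ultimately show ?case by (simp del: incr_colour.simps)
qed

lemma incr_colour_witness:
  assumes "y \<in> set p"
  shows "\<exists>ys. subseq (y # ys) p \<and> sorted_wrt (<) (y # ys) \<and> length ys = incr_colour p y"
  using assms
proof (induction p arbitrary: y)
  case Nil
  then show ?case by simp
next
  case (Cons x xs)
  show ?case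
  proof (cases "y = x")
    case False
    then show ?thesis using Cons by (auto intro: subseq_Cons')
  next
    case True
    \<comment> \<open>The maximum is attained: either at the default 0, where \<open>y\<close> alone
      is the witness, or at a later larger \<open>z\<close>, whose witness is prolonged by
      \<open>x\<close>.\<close>
    have "Max (insert 0 (Suc ` incr_colour xs ` {z \<in> set xs. x < z}))
        \<in> insert 0 (Suc ` incr_colour xs ` {z \<in> set xs. x < z})"
      by (rule Max_in) auto
    then consider "incr_colour (x # xs) x = 0"
      | z where "z \<in> set xs" "x < z" "incr_colour (x # xs) x = Suc (incr_colour xs z)"
      by auto
    then show ?thesis
    proof cases
      case 1
      then show ?thesis using True by (intro exI[of _ "[]"]) simp
    next
      case 2
      with Cons.IH obtain ys where "subseq (z # ys) xs" "sorted_wrt (<) (z # ys)"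
        "length ys = incr_colour xs z"
        by blast
      with 2 True show ?thesis by (intro exI[of _ "z # ys"]) (auto simp del: incr_colour.simps)
    qed
  qed
qed

lemma has_incr_subseq_mono:
  assumes "has_incr_subseq m p" "k \<le> m"
  shows "has_incr_subseq k p"
proof -
  obtain ys where "subseq ys p" "sorted_wrt (<) ys" "length ys = m"
    using assms(1) by (auto simp: has_incr_subseq_def)
  moreover have "subseq (take k ys) ys" by (simp add: prefix_imp_subseq take_is_prefix)
  ultimately show ?thesis
    unfolding has_incr_subseq_def using assms(2)
    by (intro exI[of _ "take k ys"]) (auto intro: subseq_order.order_trans sorted_wrt_take)
qed

text \<open>Colours start at 0, so a colour of at least \<open>k\<close> would yield an increasing
  subsequence of length at least \<open>Suc k\<close>. Hence only the colours below \<open>k\<close>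
  occur.\<close>

lemma min_stacks_le:
  assumes "p \<in> permutations_of_set {1..n}" "\<not> has_incr_subseq (Suc k) p"
  shows "min_stacks p \<le> k"
proof -
  have "incr_colour p x < k" if "x \<in> set p" for x
  proof (rule ccontr)
    assume "\<not> incr_colour p x < k"
    moreover have "has_incr_subseq (Suc (incr_colour p x)) p"
      using incr_colour_witness[OF that] unfolding has_incr_subseq_def by (metis length_Cons)
    ultimately show False using has_incr_subseq_mono assms(2) by (metis Suc_le_mono not_less)
  qed
  then have "sorted_by_stacks k p"
    using assms(1) by (intro sorted_by_stacks_if_coloured[of p n "incr_colour p"])
      (auto intro: sorted_wrt_incr_colour simp: permutations_of_set_def)
  then show ?thesis unfolding min_stacks_def by (rule Least_le)
qed

section \<open>Counting permutations with a long increasing subsequence\<close>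

lemma has_incr_subseq_imp_shuffle:
  assumes "p \<in> permutations_of_set A" "has_incr_subseq k p"
  shows "\<exists>V\<subseteq>A. card V = k \<and>
    (\<exists>q\<in>permutations_of_set (A - V). p \<in> shuffles (sorted_list_of_set V) q)"
proof -
  obtain ys where ys: "subseq ys p" "sorted_wrt (<) ys" "length ys = k"
    using assms(2) by (auto simp: has_incr_subseq_def)
  have p: "set p = A" "distinct p" using assms(1) by (auto simp: permutations_of_set_def)
  have dist: "distinct ys" using ys(2) by (simp add: strict_sorted_iff)
  \<comment> \<open>Since \<open>p\<close> is distinct, the subsequence is recovered from its set of
    values; this set serves as \<open>V\<close>.\<close>
  have "filter (\<lambda>x. x \<in> set ys) p = ys"
    using ys(1) p(2) by (auto simp: subseq_conv_nths filter_in_nths)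
  moreover have "sorted_list_of_set (set ys) = ys"
    using ys(2) by (simp add: sorted_list_of_set.idem_if_sorted_distinct strict_sorted_iff)
  ultimately have "p \<in> shuffles (sorted_list_of_set (set ys)) (filter (\<lambda>x. x \<notin> set ys) p)"
    using partition_in_shuffles[of p "\<lambda>x. x \<in> set ys"] by simp
  moreover have "filter (\<lambda>x. x \<notin> set ys) p \<in> permutations_of_set (A - set ys)"
    using p by (auto simp: permutations_of_set_def)
  moreover have "set ys \<subseteq> A" using ys(1) p(1) by (metis set_nths_subset subseq_conv_nths)
  moreover have "card (set ys) = k" using dist ys(3) by (simp add: distinct_card)
  ultimately show ?thesis by blast
qed

text \<open>Union bound: one binomial counts the sets \<open>V\<close>, the factorial the
  arrangements of the rest, the other binomial the shuffles of the two lists.\<close>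

lemma card_has_incr_subseq_le:
  fixes A :: "'a::linorder set"
  assumes "finite A"
  shows "card {p \<in> permutations_of_set A. has_incr_subseq k p} \<le>
    (card A choose k)\<^sup>2 * fact (card A - k)"
proof -
  let ?Vs = "{V. V \<subseteq> A \<and> card V = k}"
  let ?U = "\<lambda>V. \<Union>q\<in>permutations_of_set (A - V). shuffles (sorted_list_of_set V) q"
  have fin: "finite ?Vs" using assms by auto
  have finU: "finite (?U V)" for V
    using assms by (intro finite_UN_I) auto
  have "card (?U V) \<le> (card A choose k) * fact (card A - k)" if "V \<in> ?Vs" for V
  proof -
    have V: "V \<subseteq> A" "card V = k" "finite V" using that assms finite_subset by auto
    have "card (?U V) \<le> (\<Sum>q\<in>permutations_of_set (A - V). card (shuffles (sorted_list_of_set V) q))"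
      using assms by (intro card_UN_le) auto
    also have "\<dots> = (\<Sum>q\<in>permutations_of_set (A - V). card A choose k)"
    proof (rule sum.cong)
      fix q assume q: "q \<in> permutations_of_set (A - V)"
      then have "set q = A - V" by (auto simp: permutations_of_set_def)
      moreover have "length q = card A - k"
        using length_finite_permutations_of_set[OF q] V assms by (simp add: card_Diff_subset)
      \<comment> \<open>This makes the truncated difference exact: the lengths \<open>k\<close> and
        \<open>card A - k\<close> add up to \<open>card A\<close>.\<close>
      moreover have "k \<le> card A" using V assms by (metis card_mono)
      ultimately show "card (shuffles (sorted_list_of_set V) q) = card A choose k"
        using V by (subst card_disjoint_shuffles) auto
    qed simp
    also have "\<dots> = fact (card A - k) * (card A choose k)"
      using V assms by (simp add: card_Diff_subset)
    finally show ?thesis by (simp add: mult.commute)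
  qed
  note U = this
  have "card {p \<in> permutations_of_set A. has_incr_subseq k p} \<le> card (\<Union>V\<in>?Vs. ?U V)"
  proof (rule card_mono)
    show "finite (\<Union>V\<in>?Vs. ?U V)" using fin finU by (rule finite_UN_I)
    show "{p \<in> permutations_of_set A. has_incr_subseq k p} \<subseteq> (\<Union>V\<in>?Vs. ?U V)"
    proof
      fix p assume "p \<in> {p \<in> permutations_of_set A. has_incr_subseq k p}"
      then obtain V q where "V \<subseteq> A" "card V = k" "q \<in> permutations_of_set (A - V)"
        "p \<in> shuffles (sorted_list_of_set V) q"
        using has_incr_subseq_imp_shuffle[of p A k] by auto
      then show "p \<in> (\<Union>V\<in>?Vs. ?U V)" by blast
    qed
  qed
  also have "\<dots> \<le> (\<Sum>V\<in>?Vs. card (?U V))" using fin by (rule card_UN_le)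
  also have "\<dots> \<le> card ?Vs * ((card A choose k) * fact (card A - k))"
    using sum_bounded_above[of ?Vs "\<lambda>V. card (?U V)"] U by simp
  also have "card ?Vs = card A choose k" using assms by (rule n_subsets)
  finally show ?thesis by (simp add: power2_eq_square mult.assoc)
qed

subsection \<open>Expected length\<close>

text \<open>A weak Stirling bound: a single term of the exponential series at \<open>k\<close> is at
  most the whole sum.\<close>

lemma power_self_le_exp_mult_fact: "real k ^ k \<le> exp (real k) * fact k"
proof -
  have "real k ^ k /\<^sub>R fact k \<le> exp (real k)"
    using summable_exp_generic[of "real k"]
      sum_le_suminf[of "\<lambda>n. real k ^ n /\<^sub>R fact n" "{k}"]
    by (simp add: exp_def)
  then show ?thesis by (simp add: field_simps)
qed

text \<open>The binomial is at most \<open>n ^ k / fact k\<close>, so \<open>fact k\<close> occurs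
  squared in the denominator; applying the Stirling bound to both factors produces
  \<open>exp 2\<close>.\<close>

lemma choose_div_fact_le:
  assumes "k > 0"
  shows "real (n choose k) / fact k \<le> (exp 2 * real n / real k ^ 2) ^ k"
proof -
  have fact_le: "1 / fact k \<le> exp (real k) / real k ^ k"
    using power_self_le_exp_mult_fact[of k] assms by (simp add: field_simps)
  have "real (n choose k) * fact k \<le> real n ^ k"
    using binomial_fact_pow[of n k] by (metis of_nat_fact of_nat_le_iff of_nat_mult of_nat_power)
  then have "real (n choose k) / fact k \<le> real n ^ k * (1 / fact k)\<^sup>2"
    by (simp add: field_simps power2_eq_square)
  also have "\<dots> \<le> real n ^ k * (exp (real k) / real k ^ k)\<^sup>2"
    using fact_le by (intro mult_left_mono power_mono) auto
  also have "\<dots> = (exp 2 * real n / real k ^ 2) ^ k"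
  proof -
    have "(exp (real k))\<^sup>2 = exp 2 ^ k"
      by (simp add: mult.commute flip: exp_of_nat_mult exp_double)
    moreover have "(real k ^ k)\<^sup>2 = (real k ^ 2) ^ k" by (simp add: mult.commute flip: power_mult)
    ultimately show ?thesis by (simp add: power_mult_distrib power_divide)
  qed
  finally show ?thesis .
qed

lemma prob_has_incr_subseq_le:
  assumes "finite A"
  shows "measure_pmf.prob (pmf_of_set (permutations_of_set A)) {p. has_incr_subseq k p} \<le>
    real (card A choose k) / fact k"
proof -
  have "measure_pmf.prob (pmf_of_set (permutations_of_set A)) {p. has_incr_subseq k p} =
      real (card {p \<in> permutations_of_set A. has_incr_subseq k p}) / fact (card A)"
    using assms by (subst measure_pmf_of_set) (auto simp: Int_def)
  also have "\<dots> \<le> real ((card A choose k)\<^sup>2 * fact (card A - k)) / fact (card A)"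
    using card_has_incr_subseq_le[OF assms, of k] by (intro divide_right_mono)
      (simp_all only: of_nat_le_iff fact_ge_zero)
  also have "\<dots> = real (card A choose k) / fact k"
  \<comment> \<open>One binomial factor cancels against the factorials down to
    \<open>1 / fact k\<close>; for larger \<open>k\<close> both sides vanish.\<close>
  proof (cases "k \<le> card A")
    case True
    then show ?thesis by (simp add: binomial_fact power2_eq_square)
  qed (simp add: binomial_eq_0)
  finally show ?thesis .
qed

lemma expectation_min_stacks_le:
  "measure_pmf.expectation (pmf_of_set (permutations_of_set {1..n})) (\<lambda>p. real (min_stacks p)) \<le>
    2 * exp 1 * sqrt (real n) + 2"
proof (cases "n = 0")
  case True
  have "min_stacks [] \<le> 0"
    using sorted_by_n_stacks[of "[]" 0] unfolding min_stacks_def by (intro Least_le) auto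
  then show ?thesis using True by (simp add: pmf_of_set_singleton)
next
  case False
  \<comment> \<open>The factor \<open>2 * exp 1\<close> gives
    \<open>exp 2 * n / k ^ 2 \<le> 1 / 4\<close>. Rounding up costs one of the two units in the
    final bound, the event \<open>?B\<close> the other.\<close>
  define k where "k = nat \<lceil>2 * exp 1 * sqrt (real n)\<rceil>"
  have k: "2 * exp 1 * sqrt (real n) \<le> real k" "real k \<le> 2 * exp 1 * sqrt (real n) + 1"
    unfolding k_def by simp_all linarith?
  have "0 < 2 * exp 1 * sqrt (real n)" using False by simp
  then have "k > 0" using k(1) by linarith
  let ?M = "pmf_of_set (permutations_of_set {1..n})"
  let ?B = "{p::nat list. has_incr_subseq k p}"
  have set: "set_pmf ?M = permutations_of_set {1..n}" by (subst set_pmf_of_set) auto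
  have fin: "finite (set_pmf ?M)" unfolding set by simp
  have int: "integrable (measure_pmf ?M) f" for f :: "nat list \<Rightarrow> real"
    using fin by (rule integrable_measure_pmf_finite)
  have "measure_pmf.expectation ?M (\<lambda>p. real (min_stacks p)) \<le>
      measure_pmf.expectation ?M (\<lambda>p. real k + real n * indicator ?B p)"
  proof (rule integral_mono_AE[OF int int], rule AE_pmfI)
    fix p assume "p \<in> set_pmf ?M"
    then have p: "p \<in> permutations_of_set {1..n}" using set by simp
    have "min_stacks p \<le> n"
      unfolding min_stacks_def by (rule Least_le) (rule sorted_by_n_stacks[OF p])
    \<comment> \<open>No increasing subsequence of length \<open>k\<close> means none of length
      \<open>Suc k\<close> either.\<close>
    moreover have "min_stacks p \<le> k" if "\<not> has_incr_subseq k p"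
      using that has_incr_subseq_mono[of "Suc k" p k] min_stacks_le[OF p] by auto
    ultimately show "real (min_stacks p) \<le> real k + real n * indicator ?B p"
      by (auto simp: indicator_def)
  qed
  also have "\<dots> = real k + real n * measure_pmf.prob ?M ?B"
    by (subst Bochner_Integration.integral_add[OF int int]) simp
  also have "measure_pmf.prob ?M ?B \<le> (1 / 4) ^ k"
  proof -
    have "(2 * exp 1 * sqrt (real n))\<^sup>2 \<le> (real k)\<^sup>2"
      using k(1) by (intro power_mono) auto
    then have "4 * (exp 2 * real n) \<le> (real k)\<^sup>2"
      by (simp add: power_mult_distrib flip: exp_double)
    then have "exp 2 * real n / (real k)\<^sup>2 \<le> 1 / 4" using \<open>k > 0\<close> by (simp add: field_simps)
    then have "(exp 2 * real n / real k ^ 2) ^ k \<le> (1 / 4) ^ k" by (intro power_mono) auto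
    then show ?thesis
      using prob_has_incr_subseq_le[of "{1..n}" k] choose_div_fact_le[OF \<open>k > 0\<close>, of n] by simp
  qed
  \<comment> \<open>Squaring \<open>sqrt n \<le> k \<le> 2 ^ k\<close> gives
    \<open>n \<le> 4 ^ k\<close>.\<close>
  also have "real n * (1 / 4) ^ k \<le> 1"
  proof -
    have "1 * sqrt (real n) \<le> 2 * exp 1 * sqrt (real n)"
      by (intro mult_right_mono) (use exp_ge_add_one_self[of "1::real"] in auto)
    then have "sqrt (real n) \<le> real k" using k(1) by simp
    also have "\<dots> \<le> 2 ^ k" by (simp add: less_imp_le of_nat_less_two_power)
    finally have "(sqrt (real n))\<^sup>2 \<le> (2 ^ k)\<^sup>2" by (intro power_mono) auto
    also have "(2 ^ k)\<^sup>2 = (4::real) ^ k" by (simp add: power2_eq_square flip: power_mult_distrib)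
    finally show ?thesis by (simp add: field_simps power_one_over)
  qed
  finally show ?thesis using k(2) by (simp add: mult_left_mono)
qed

theorem theorem3:
  shows "(\<lambda>n. measure_pmf.expectation (pmf_of_set (permutations_of_set {1..n}))
              (\<lambda>p. real (min_stacks p)))
         \<in> O(\<lambda>n. sqrt (real n))"
proof (rule bigoI)
  show "\<forall>\<^sub>F n in sequentially.
      norm (measure_pmf.expectation (pmf_of_set (permutations_of_set {1..n}))
        (\<lambda>p. real (min_stacks p))) \<le> (2 * exp 1 + 2) * norm (sqrt (real n))"
    \<comment> \<open>For \<open>n \<ge> 1\<close> the additive constant 2 is absorbed into
      \<open>2 * sqrt n\<close>.\<close>
    using eventually_ge_at_top[of 1]
  proof eventually_elim
    case (elim n)
    have "0 \<le> measure_pmf.expectation (pmf_of_set (permutations_of_set {1..n}))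
        (\<lambda>p. real (min_stacks p))"
      by (intro Bochner_Integration.integral_nonneg) simp
    moreover have "1 \<le> sqrt (real n)" using elim by simp
    ultimately show ?case
      using expectation_min_stacks_le[of n] by (simp add: distrib_right del: real_sqrt_ge_1_iff)
  qed
qed

end
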